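(* Let $G$ be a finite simple connected graph that has at least one perfect matching, and let $\rho(G)$ be its spectral radius. Then \[\mathrm{cf}(G) \le \left( 1 - \frac{1}{\rho(G)} \right) |E(G)|.\]
   Context: A perfect matching of $G$ is a set of pairwise disjoint edges covering every vertex. For a perfect matching $M$, a subset $S\subseteq M$ is a forcing set of $M$ if $M$ is the unique perfect matching of $G$ containing $S$. A subset $S\subseteq E(G)$ is a complete forcing set of $G$ if for every perfect matching $M$ of $G$, the set $S\cap M$ is a forcing set of $M$. The complete forcing number $\mathrm{cf}(G)$ is the minimum size of a complete forcing set of $G$. The spectral radius $\rho(G)$ is the largest absolute value of an eigenvalue of the adjacency matrix of $G$. *)

theory Defs
  imports
    "Graph_Theory.Digraph_Component"
    "Jordan_Normal_Form.Spectral_Radius"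
begin

text \<open>
  A finite simple graph is a \<^locale>\<open>pair_graph\<close>: a finite vertex set with a symmetric,
  irreflexive set of arcs. Each undirected edge is represented by two opposite arcs, so the
  edge set is recovered by forgetting the orientation.
\<close>

definition edges :: "'a pair_pre_digraph \<Rightarrow> 'a set set" where
  "edges G = {{u, v} | u v. (u, v) \<in> parcs G}"

definition perfect_matching :: "'a pair_pre_digraph \<Rightarrow> 'a set set \<Rightarrow> bool" where
  "perfect_matching G M \<longleftrightarrow> M \<subseteq> edges G \<and> pairwise disjnt M \<and> \<Union>M = pverts G"

definition forcing_set :: "'a pair_pre_digraph \<Rightarrow> 'a set set \<Rightarrow> 'a set set \<Rightarrow> bool" where
  "forcing_set G M S \<longleftrightarrow> perfect_matching G M \<and> S \<subseteq> M \<and>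
     (\<forall>M'. perfect_matching G M' \<and> S \<subseteq> M' \<longrightarrow> M' = M)"

definition complete_forcing_set :: "'a pair_pre_digraph \<Rightarrow> 'a set set \<Rightarrow> bool" where
  "complete_forcing_set G S \<longleftrightarrow> S \<subseteq> edges G \<and>
     (\<forall>M. perfect_matching G M \<longrightarrow> forcing_set G M (S \<inter> M))"

definition complete_forcing_number :: "'a pair_pre_digraph \<Rightarrow> nat" where
  "complete_forcing_number G = (LEAST k. \<exists>S. complete_forcing_set G S \<and> card S = k)"

text \<open>
  The minimum is over a nonempty family: the full edge set is a complete forcing set.
\<close>

lemma perfect_matching_subset_eq:
  assumes "perfect_matching G M" "perfect_matching G M'" "M \<subseteq> M'"
  shows "M' = M"
proof (rule ccontr)
  assume "M' \<noteq> M"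
  with assms(3) obtain e where e: "e \<in> M'" "e \<notin> M" by blast
  from e(1) assms(2) have "e \<in> edges G" by (auto simp: perfect_matching_def)
  then obtain u where u: "u \<in> e" by (auto simp: edges_def)
  with e(1) assms(1,2) have "u \<in> \<Union>M" by (auto simp: perfect_matching_def)
  then obtain f where f: "f \<in> M" "u \<in> f" by blast
  with assms(3) e have "f \<in> M'" "f \<noteq> e" by auto
  with assms(2) e(1) have "disjnt f e" by (auto simp: perfect_matching_def pairwise_def)
  with f(2) u show False by (auto simp: disjnt_def)
qed

lemma complete_forcing_set_edges: "complete_forcing_set G (edges G)"
  unfolding complete_forcing_set_def forcing_set_def
proof (intro conjI allI impI)
  fix M M' assume M: "perfect_matching G M" and *: "perfect_matching G M' \<and> edges G \<inter> M \<subseteq> M'"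
  from M have "edges G \<inter> M = M" by (auto simp: perfect_matching_def)
  with M * show "M' = M" using perfect_matching_subset_eq by metis
qed auto

text \<open>
  Matrices are indexed by natural numbers, so the adjacency matrix depends on an enumeration of
  the vertices; the entries are complex because \<^const>\<open>spectral_radius\<close> is defined
  for complex matrices.
\<close>

definition adjacency_mat :: "'a pair_pre_digraph \<Rightarrow> 'a list \<Rightarrow> complex mat" where
  "adjacency_mat G vs =
     mat (length vs) (length vs) (\<lambda>(i, j). if (vs ! i, vs ! j) \<in> parcs G then 1 else 0)"

definition graph_spectral_radius :: "'a pair_pre_digraph \<Rightarrow> real" where
  "graph_spectral_radius G =
     spectral_radius (adjacency_mat G (SOME vs. distinct vs \<and> set vs = pverts G))"

text \<open>
  The spectrum, and hence \<^const>\<open>graph_spectral_radius\<close>, does not depend on the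
  chosen enumeration.
\<close>

lemma spectrum_adjacency_mat:
  assumes vs: "distinct vs" "set vs = pverts G"
  shows "spectrum (adjacency_mat G vs) =
    {k. \<exists>x. (\<exists>u\<in>pverts G. x u \<noteq> 0) \<and>
       (\<forall>u\<in>pverts G. (\<Sum>v\<in>pverts G. (if (u, v) \<in> parcs G then 1 else 0) * x v) = k * x u)}"
    (is "_ = {k. \<exists>x. ?P k x}")
proof -
  let ?n = "length vs"
  have bij: "bij_betw ((!) vs) {0..<?n} (pverts G)"
    using vs by (metis bij_betw_nth atLeast0LessThan)
  have mult: "(adjacency_mat G vs *\<^sub>v w) $ i =
      (\<Sum>v\<in>pverts G. (if (vs ! i, v) \<in> parcs G then 1 else 0) * x v)"
    if "i < ?n" "w \<in> carrier_vec ?n" "\<And>j. j < ?n \<Longrightarrow> w $ j = x (vs ! j)" for i w x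
  proof -
    have "(adjacency_mat G vs *\<^sub>v w) $ i =
        (\<Sum>j = 0..<?n. (if (vs ! i, vs ! j) \<in> parcs G then 1 else 0) * x (vs ! j))"
      using that by (auto simp: adjacency_mat_def scalar_prod_def intro!: sum.cong)
    also have "\<dots> = (\<Sum>v\<in>pverts G. (if (vs ! i, v) \<in> parcs G then 1 else 0) * x v)"
      by (rule sum.reindex_bij_betw[OF bij])
    finally show ?thesis .
  qed
  have all: "(\<forall>u\<in>pverts G. Q u) \<longleftrightarrow> (\<forall>i<?n. Q (vs ! i))" for Q
    using vs(2) by (metis all_set_conv_all_nth)
  have ev: "eigenvector (adjacency_mat G vs) w k \<longleftrightarrow> ?P k x"
    if w: "w \<in> carrier_vec ?n" and wx: "\<And>j. j < ?n \<Longrightarrow> w $ j = x (vs ! j)" for w k x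
  proof -
    have dim: "dim_row (adjacency_mat G vs) = ?n" by (simp add: adjacency_mat_def)
    have "w \<noteq> 0\<^sub>v ?n \<longleftrightarrow> \<not> (\<forall>u\<in>pverts G. x u = 0)"
      unfolding all using w by (auto simp: vec_eq_iff wx)
    moreover have "adjacency_mat G vs *\<^sub>v w = k \<cdot>\<^sub>v w \<longleftrightarrow> (\<forall>u\<in>pverts G.
        (\<Sum>v\<in>pverts G. (if (u, v) \<in> parcs G then 1 else 0) * x v) = k * x u)"
      unfolding all using w by (simp add: vec_eq_iff dim wx mult[OF _ w wx] del: index_mult_mat_vec)
    ultimately show ?thesis unfolding eigenvector_def dim using w by auto
  qed
  show ?thesis
  proof (intro subset_antisym subsetI)
    fix k assume "k \<in> spectrum (adjacency_mat G vs)"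
    then obtain w where w: "eigenvector (adjacency_mat G vs) w k"
      by (auto simp: spectrum_def eigenvalue_def)
    then have c: "w \<in> carrier_vec ?n" by (simp add: eigenvector_def adjacency_mat_def)
    define x where "x = (\<lambda>v. w $ inv_into {0..<?n} ((!) vs) v)"
    have "w $ j = x (vs ! j)" if "j < ?n" for j
      using bij that by (simp add: x_def inv_into_f_f bij_betw_def)
    from ev[OF c this] w show "k \<in> {k. \<exists>x. ?P k x}" by blast
  next
    fix k assume "k \<in> {k. \<exists>x. ?P k x}"
    then obtain x where x: "?P k x" by blast
    have "eigenvector (adjacency_mat G vs) (vec ?n (\<lambda>i. x (vs ! i))) k"
      using x by (subst ev[where x = x]) auto
    then show "k \<in> spectrum (adjacency_mat G vs)" by (auto simp: spectrum_def eigenvalue_def)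
  qed
qed

lemma graph_spectral_radius_eq:
  assumes "distinct vs" "set vs = pverts G"
  shows "graph_spectral_radius G = spectral_radius (adjacency_mat G vs)"
proof -
  let ?ws = "SOME vs. distinct vs \<and> set vs = pverts G"
  have "distinct ?ws \<and> set ?ws = pverts G"
    using assms by (intro someI[where P = "\<lambda>vs. distinct vs \<and> set vs = pverts G"]) blast
  then show ?thesis
    using assms by (simp add: graph_spectral_radius_def spectral_radius_def spectrum_adjacency_mat)
qed

end

theory Submission
  imports Defs "HOL-Analysis.Convex"
begin

text \<open>
  Let \<open>n\<close> be the number of vertices and \<open>I\<close> a maximal independent set, linearly ordered. Join
  every vertex outside \<open>I\<close> to its first neighbour in \<open>I\<close>; these edges form a set \<open>T\<close> with
  \<open>n - |I|\<close> elements. If \<open>M\<close> and \<open>M'\<close> are distinct perfect matchings with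
  \<open>M - M' \<subseteq> T\<close>, consider the edge of \<open>M - M'\<close> with the first endpoint \<open>v \<in> I\<close>: the
  \<open>M'\<close>-partner of \<open>v\<close> is matched by \<open>M\<close> to a strictly earlier vertex of \<open>I\<close>, a
  contradiction. So the complement of \<open>T\<close> is a complete forcing set. An edge of a perfect
  matching contains at most one vertex of \<open>I\<close>, so \<open>|T| \<ge> n / 2\<close>. Finally
  \<open>n / 2 \<ge> |E| / \<rho>\<close> because \<open>\<rho>\<close> is at least the average degree \<open>2|E| / n\<close>.
\<close>

section \<open>A Rayleigh quotient bound for the spectral radius\<close>

text \<open>The operator acts on real functions, where order and Cauchy-Schwarz are at hand.
  \<open>kernel_mat\<close> is its complex copy, as \<open>spectral_radius\<close> takes complex
  matrices.\<close>

definition apply_kernel :: "nat \<Rightarrow> (nat \<Rightarrow> nat \<Rightarrow> real) \<Rightarrow> (nat \<Rightarrow> real) \<Rightarrow> nat \<Rightarrow> real" where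
  "apply_kernel n a x i = (\<Sum>j<n. a i j * x j)"

definition kernel_mat :: "nat \<Rightarrow> (nat \<Rightarrow> nat \<Rightarrow> real) \<Rightarrow> complex mat" where
  "kernel_mat n a = mat n n (\<lambda>(i, j). complex_of_real (a i j))"

lemma kernel_mat_carrier [simp]: "kernel_mat n a \<in> carrier_mat n n"
  by (simp add: kernel_mat_def)

lemma kernel_mat_mult_vec:
  "kernel_mat n a *\<^sub>v vec n (\<lambda>i. complex_of_real (x i)) =
    vec n (\<lambda>i. complex_of_real (apply_kernel n a x i))"
  by (rule eq_vecI) (auto simp: kernel_mat_def apply_kernel_def scalar_prod_def
    atLeast0LessThan intro!: sum.cong)

lemma kernel_mat_pow_mult_vec:
  "(kernel_mat n a ^\<^sub>m k) *\<^sub>v vec n (\<lambda>i. complex_of_real (x i)) =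
    vec n (\<lambda>i. complex_of_real ((apply_kernel n a ^^ k) x i))"
proof (induction k arbitrary: x)
  case 0
  show ?case by (simp add: kernel_mat_def)
next
  case (Suc k)
  have "(kernel_mat n a ^\<^sub>m Suc k) *\<^sub>v vec n (\<lambda>i. complex_of_real (x i)) =
      (kernel_mat n a ^\<^sub>m k) *\<^sub>v (kernel_mat n a *\<^sub>v vec n (\<lambda>i. complex_of_real (x i)))"
    by (simp add: assoc_mult_mat_vec[where n\<^sub>1 = n and n\<^sub>2 = n and n\<^sub>3 = n])
  then show ?case
    by (simp add: kernel_mat_mult_vec Suc.IH funpow_swap1)
qed

lemma apply_kernel_self_adjoint:
  assumes "\<And>i j. i < n \<Longrightarrow> j < n \<Longrightarrow> a i j = a j i"
  shows "(\<Sum>i<n. x i * apply_kernel n a y i) = (\<Sum>i<n. apply_kernel n a x i * y i)"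
proof -
  have "(\<Sum>i<n. x i * apply_kernel n a y i) = (\<Sum>i<n. \<Sum>j<n. x i * (a i j * y j))"
    by (simp add: apply_kernel_def sum_distrib_left)
  also have "\<dots> = (\<Sum>j<n. \<Sum>i<n. x i * (a i j * y j))"
    by (rule sum.swap)
  also have "\<dots> = (\<Sum>j<n. \<Sum>i<n. a j i * x i * y j)"
    using assms by (intro sum.cong refl) simp
  also have "\<dots> = (\<Sum>i<n. apply_kernel n a x i * y i)"
    by (simp add: apply_kernel_def sum_distrib_right)
  finally show ?thesis .
qed

text \<open>Operators cross the pairing one at a time, each raising \<open>l\<close>. For
  \<open>k = l\<close> the even moment becomes a squared norm.\<close>

lemma apply_kernel_pow_self_adjoint:
  assumes "\<And>i j. i < n \<Longrightarrow> j < n \<Longrightarrow> a i j = a j i"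
  shows "(\<Sum>i<n. x i * (apply_kernel n a ^^ (k + l)) x i) =
    (\<Sum>i<n. (apply_kernel n a ^^ k) x i * (apply_kernel n a ^^ l) x i)"
proof (induction k arbitrary: l)
  case (Suc k)
  show ?case
    using Suc.IH[of "Suc l"] apply_kernel_self_adjoint[OF assms] by simp
qed simp

lemma spectral_radius_nonneg:
  assumes "A \<in> carrier_mat n n" "n > 0"
  shows "spectral_radius A \<ge> 0"
  using spectral_radius_mem_max(1)[OF assms] by auto

text \<open>An eigenvector of the rescaled matrix for \<open>k\<close> is one of the original matrix
  for \<open>c * k\<close>.\<close>

lemma spectral_radius_kernel_mat_divide:
  assumes "n > 0" "c > 0" "spectral_radius (kernel_mat n a) < c"
  shows "spectral_radius (kernel_mat n (\<lambda>i j. a i j / c)) < 1"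
proof -
  let ?A = "kernel_mat n a" and ?B = "kernel_mat n (\<lambda>i j. a i j / c)"
  obtain k where k: "spectral_radius ?B = norm k" "k \<in> spectrum ?B"
    using spectral_radius_mem_max(1)[OF kernel_mat_carrier \<open>n > 0\<close>] by blast
  then obtain v where v: "eigenvector ?B v k"
    by (auto simp: spectrum_def eigenvalue_def)
  have A: "?A = complex_of_real c \<cdot>\<^sub>m ?B"
    by (rule eq_matI) (use \<open>c > 0\<close> in \<open>auto simp: kernel_mat_def\<close>)
  have vc: "v \<in> carrier_vec n"
    using v by (simp add: eigenvector_def kernel_mat_def)
  have "?A *\<^sub>v v = complex_of_real c \<cdot>\<^sub>v (?B *\<^sub>v v)"
    using vc unfolding A by (intro eq_vecI) (auto simp: kernel_mat_def)
  then have "eigenvector ?A v (c * k)"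
    using v by (simp add: eigenvector_def kernel_mat_def smult_smult_assoc)
  then have "c * k \<in> spectrum ?A"
    by (auto simp: spectrum_def eigenvalue_def)
  then have "norm (c * k) \<le> spectral_radius ?A"
    using spectral_radius_mem_max(2)[OF kernel_mat_carrier \<open>n > 0\<close>] by blast
  then have "c * norm k \<le> spectral_radius ?A" using \<open>c > 0\<close> by (simp add: norm_mult)
  then have "c * norm k < c * 1" using assms(3) by linarith
  then have "norm k < 1" using \<open>c > 0\<close> by (simp only: mult_less_cancel_left_pos)
  with k(1) show ?thesis by simp
qed

text \<open>By the Jordan normal form, spectral radius below 1 bounds the entries of all powers by
  one constant, which does not depend on \<open>k\<close>.\<close>

lemma kernel_pow_bounded:
  assumes "spectral_radius (kernel_mat n a) < 1"
  shows "\<exists>C. \<forall>k. (\<Sum>i<n. x i * (apply_kernel n a ^^ k) x i) \<le> C"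
proof -
  obtain c where c: "\<And>k. norm_bound (kernel_mat n a ^\<^sub>m k) c"
    using spectral_radius_jnf_norm_bound_less_1_upper_triangular[OF kernel_mat_carrier assms]
    by blast
  have "(\<Sum>i<n. x i * (apply_kernel n a ^^ k) x i) \<le> (\<Sum>i<n. \<bar>x i\<bar> * (\<Sum>j<n. c * \<bar>x j\<bar>))" for k
  proof (rule sum_mono)
    fix i assume "i \<in> {..<n}"
    then have i: "i < n" by simp
    let ?P = "kernel_mat n a ^\<^sub>m k"
    have dim: "dim_row ?P = n" "dim_col ?P = n"
      by (simp_all add: kernel_mat_def)
    have "complex_of_real ((apply_kernel n a ^^ k) x i) =
        (?P *\<^sub>v vec n (\<lambda>i. complex_of_real (x i))) $ i"
      using i by (simp add: kernel_mat_pow_mult_vec)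
    also have "\<dots> = (\<Sum>j<n. ?P $$ (i, j) * complex_of_real (x j))"
      using i dim by (simp add: scalar_prod_def atLeast0LessThan)
    finally have "\<bar>(apply_kernel n a ^^ k) x i\<bar> =
        norm (\<Sum>j<n. ?P $$ (i, j) * complex_of_real (x j))"
      by (metis norm_of_real)
    also have "\<dots> \<le> (\<Sum>j<n. c * \<bar>x j\<bar>)"
      using c[of k] i dim
      by (intro sum_norm_le) (auto simp: norm_mult norm_bound_def intro!: mult_right_mono)
    finally have "\<bar>x i\<bar> * \<bar>(apply_kernel n a ^^ k) x i\<bar> \<le> \<bar>x i\<bar> * (\<Sum>j<n. c * \<bar>x j\<bar>)"
      by (rule mult_left_mono) simp
    then show "x i * (apply_kernel n a ^^ k) x i \<le> \<bar>x i\<bar> * (\<Sum>j<n. c * \<bar>x j\<bar>)"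
      by (metis abs_ge_self abs_mult order_trans)
  qed
  then show ?thesis by blast
qed

text \<open>
  Otherwise, after rescaling, all eigenvalues are smaller than \<open>1\<close>, so the moments
  \<open>x\<^sup>T a\<^sup>k x\<close> are bounded, while by Cauchy-Schwarz the moments for \<open>k = 2\<^sup>j\<close> grow
  at least geometrically.
\<close>

lemma rayleigh_quotient_le_spectral_radius:
  assumes n: "n > 0" and sym: "\<And>i j. i < n \<Longrightarrow> j < n \<Longrightarrow> a i j = a j i"
  shows "(\<Sum>i<n. x i * apply_kernel n a x i) \<le> spectral_radius (kernel_mat n a) * (\<Sum>i<n. (x i)\<^sup>2)"
    (is "?Q \<le> ?\<rho> * ?N")
proof (rule ccontr)
  assume less: "\<not> ?Q \<le> ?\<rho> * ?N"
  have "?N \<noteq> 0"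
  proof
    assume "?N = 0"
    then have "\<forall>i<n. x i = 0" by (simp add: sum_nonneg_eq_0_iff)
    with less show False by simp
  qed
  then have N: "?N > 0" by (simp add: sum_nonneg order_less_le)
  with less have "?\<rho> < ?Q / ?N" by (simp add: pos_less_divide_eq)
  \<comment> \<open>Dividing by a \<open>c\<close> strictly between leaves spectral radius below 1
    but Rayleigh quotient \<open>r\<close> above 1.\<close>
  then obtain c where c: "?\<rho> < c" "c < ?Q / ?N" using dense by blast
  have c0: "c > 0" using c(1) spectral_radius_nonneg[OF kernel_mat_carrier[of n a] n] by linarith
  define b where "b = (\<lambda>i j. a i j / c)"
  define S where "S k = (\<Sum>i<n. x i * (apply_kernel n b ^^ k) x i)" for k
  define r where "r = ?Q / ?N / c"
  have r: "r > 1" using c(2) c0 unfolding r_def by (simp only: less_divide_eq_1_pos)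
  have bsym: "b i j = b j i" if "i < n" "j < n" for i j
    using sym that by (simp add: b_def)
  obtain C where C: "\<And>k. S k \<le> C"
    using kernel_pow_bounded[OF spectral_radius_kernel_mat_divide[OF n c0 c(1)]]
    unfolding S_def b_def by blast
  have "apply_kernel n b x i = apply_kernel n a x i / c" for i
    by (simp add: apply_kernel_def b_def sum_divide_distrib)
  then have "S 1 = ?Q / c"
    by (simp add: S_def sum_divide_distrib)
  then have S1: "S 1 = ?N * r" using N by (simp add: r_def)
  \<comment> \<open>Cauchy-Schwarz for \<open>x\<close> and the \<open>k\<close>-th iterate of
    \<open>x\<close>, whose squared norm is \<open>S (2 * k)\<close>.\<close>
  have double: "(S k)\<^sup>2 \<le> ?N * S (2 * k)" for k
    using Cauchy_Schwarz_ineq_sum[where a = x and b = "(apply_kernel n b ^^ k) x" and I = "{..<n}"]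
      apply_kernel_pow_self_adjoint[OF bsym, where x = x and k = k and l = k]
    by (simp add: S_def power2_eq_square mult_2)
  \<comment> \<open>Squaring the hypothesis doubles the exponent and yields one surplus factor
    \<open>?N\<close>, which \<open>double\<close> cancels.\<close>
  have grow: "?N * r ^ (2 ^ j) \<le> S (2 ^ j)" for j :: nat
  proof (induction j)
    case (Suc j)
    have "?N * (?N * r ^ (2 ^ Suc j)) = (?N * r ^ (2 ^ j))\<^sup>2"
      by (simp add: power2_eq_square power_add mult_2)
    also have "\<dots> \<le> (S (2 ^ j))\<^sup>2"
      using Suc.IH N r by (intro power_mono) auto
    also have "\<dots> \<le> ?N * S (2 ^ Suc j)"
      using double[of "2 ^ j"] by simp
    finally show ?case using N by (simp only: mult_le_cancel_left_pos)
  qed (use S1 in simp)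
  \<comment> \<open>Exceeding \<open>C / ?N\<close> at exponent \<open>j\<close> suffices, because
    \<open>j \<le> 2 ^ j\<close> and \<open>r > 1\<close>.\<close>
  obtain j where j: "C / ?N < r ^ j" using real_arch_pow[OF r] by blast
  have "r ^ j \<le> r ^ (2 ^ j)"
    using r by (intro power_increasing) (auto simp: less_imp_le)
  with j have "C / ?N < r ^ (2 ^ j)" by simp
  then have "C < ?N * r ^ (2 ^ j)" using N by (simp add: pos_divide_less_eq mult.commute)
  with grow[of j] C[of "2 ^ j"] show False by simp
qed

section \<open>The spectral radius and the average degree\<close>

lemma edge_iff_arc:
  assumes "pair_graph G"
  shows "{u, v} \<in> edges G \<longleftrightarrow> (u, v) \<in> parcs G"
proof -
  interpret pair_graph G by fact
  have "(y, x) \<in> parcs G" if "(x, y) \<in> parcs G" for x y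
    using pair_sym_arcs that by (auto simp: symmetric_def elim: symE)
  then show ?thesis by (auto simp: edges_def doubleton_eq_iff)
qed

lemma arc_swap:
  assumes "pair_graph G" "(u, v) \<in> parcs G"
  shows "(v, u) \<in> parcs G"
  using assms edge_iff_arc by (metis insert_commute)

lemma finite_edges:
  assumes "pair_graph G"
  shows "finite (edges G)"
proof -
  interpret pair_graph G by fact
  have "edges G = (\<lambda>(u, v). {u, v}) ` parcs G"
    by (auto simp: edges_def image_iff)
  then show ?thesis using pair_finite_arcs by simp
qed

text \<open>Without loops, the two orientations of an edge are distinct arcs, and different edges
  have disjoint sets of arcs.\<close>

lemma card_parcs_ge:
  assumes "pair_graph G"
  shows "2 * card (edges G) \<le> card (parcs G)"
proof -
  interpret pair_graph G by fact
  let ?arcs = "\<lambda>e. {p \<in> parcs G. {fst p, snd p} = e}"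
  have two: "2 \<le> card (?arcs e)" if e: "e \<in> edges G" for e
  proof -
    obtain u v where uv: "e = {u, v}" "(u, v) \<in> parcs G"
      using e by (auto simp: edges_def)
    then have "u \<noteq> v" using pair_no_loops by force
    then have "2 = card {(u, v), (v, u)}" by simp
    also have "\<dots> \<le> card (?arcs e)"
      using uv arc_swap[OF assms] pair_finite_arcs by (intro card_mono) auto
    finally show ?thesis .
  qed
  have "2 * card (edges G) = (\<Sum>e\<in>edges G. 2)" by simp
  also have "\<dots> \<le> (\<Sum>e\<in>edges G. card (?arcs e))"
    by (rule sum_mono) (rule two)
  also have "\<dots> = card (\<Union>e\<in>edges G. ?arcs e)"
    using finite_edges[OF assms] pair_finite_arcs by (intro card_UN_disjoint[symmetric]) auto
  also have "\<dots> \<le> card (parcs G)"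
    using pair_finite_arcs by (intro card_mono) auto
  finally show ?thesis .
qed

text \<open>Rayleigh bound at the all-ones vector: the quadratic form counts the arcs, and the
  squared norm is the number of vertices.\<close>

lemma average_degree_le_spectral_radius:
  assumes G: "pair_graph G" and ne: "pverts G \<noteq> {}"
  shows "2 * real (card (edges G)) \<le> graph_spectral_radius G * real (card (pverts G))"
proof -
  interpret pair_graph G by fact
  obtain vs where vs: "distinct vs" "set vs = pverts G"
    using finite_distinct_list[OF pair_finite_verts] by blast
  let ?n = "length vs"
  define a :: "nat \<Rightarrow> nat \<Rightarrow> real" where
    "a = (\<lambda>i j. if (vs ! i, vs ! j) \<in> parcs G then 1 else 0)"
  have n: "?n > 0" "?n = card (pverts G)"
    using vs ne distinct_card[of vs] by auto
  have bij: "bij_betw ((!) vs) {..<?n} (pverts G)"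
    using vs by (metis bij_betw_nth)
  have "parcs G \<subseteq> pverts G \<times> pverts G"
    using in_arcsD1 in_arcsD2 by auto
  then have "real (card (parcs G)) =
      (\<Sum>p\<in>pverts G \<times> pverts G. if p \<in> parcs G then 1 else 0)"
    using pair_finite_verts by (simp add: sum.If_cases Int_absorb1)
  also have "\<dots> = (\<Sum>u\<in>pverts G. \<Sum>v\<in>pverts G. if (u, v) \<in> parcs G then 1 else 0)"
    by (simp add: sum.cartesian_product)
  also have "\<dots> = (\<Sum>i<?n. \<Sum>j<?n. a i j)"
    unfolding a_def by (simp add: sum.reindex_bij_betw[OF bij, symmetric])
  also have "\<dots> = (\<Sum>i<?n. 1 * apply_kernel ?n a (\<lambda>_. 1) i)"
    by (simp add: apply_kernel_def)
  also have "\<dots> \<le> spectral_radius (kernel_mat ?n a) * (\<Sum>i<?n. 1\<^sup>2)"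
    using arc_swap[OF G] by (intro rayleigh_quotient_le_spectral_radius n) (auto simp: a_def)
  also have "kernel_mat ?n a = adjacency_mat G vs"
    by (auto simp: kernel_mat_def adjacency_mat_def a_def intro!: cong_mat)
  finally have "real (card (parcs G)) \<le> graph_spectral_radius G * real (card (pverts G))"
    using n by (simp add: graph_spectral_radius_eq[OF vs])
  then show ?thesis using card_parcs_ge[OF G] by linarith
qed

section \<open>A complete forcing set from a maximal independent set\<close>

lemma perfect_matching_unique_edge:
  assumes "perfect_matching G M" "e \<in> M" "f \<in> M" "v \<in> e" "v \<in> f"
  shows "e = f"
  using assms by (auto simp: perfect_matching_def pairwise_def disjnt_def)

lemma perfect_matching_partner:
  assumes "perfect_matching G M" "v \<in> pverts G"
  obtains w where "{v, w} \<in> M"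
proof -
  obtain e where e: "e \<in> M" "v \<in> e"
    using assms by (auto simp: perfect_matching_def)
  then have "e \<in> edges G" using assms by (auto simp: perfect_matching_def)
  then obtain u w where "e = {u, w}" by (auto simp: edges_def)
  with e that show thesis by (metis insert_commute insertE singletonD)
qed

text \<open>By maximality \<open>I\<close> is dominating: a vertex outside with no neighbour in
  \<open>I\<close> could be added.\<close>

lemma maximal_independent_set:
  assumes "pair_graph G"
  obtains I where "I \<subseteq> pverts G"
    "\<And>u v. u \<in> I \<Longrightarrow> v \<in> I \<Longrightarrow> (u, v) \<notin> parcs G"
    "\<And>w. w \<in> pverts G - I \<Longrightarrow> \<exists>v\<in>I. (v, w) \<in> parcs G"
proof -
  interpret pair_graph G by fact
  let ?F = "{I. I \<subseteq> pverts G \<and> (\<forall>u\<in>I. \<forall>v\<in>I. (u, v) \<notin> parcs G)}"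
  have "finite ?F" using pair_finite_verts by simp
  moreover have "{} \<in> ?F" by simp
  ultimately have "\<exists>I\<in>?F. \<forall>J\<in>?F. I \<subseteq> J \<longrightarrow> I = J"
    by (intro finite_has_maximal) auto
  then obtain I where I: "I \<in> ?F" and max: "\<And>J. J \<in> ?F \<Longrightarrow> I \<subseteq> J \<Longrightarrow> I = J"
    by meson
  have "\<exists>v\<in>I. (v, w) \<in> parcs G" if w: "w \<in> pverts G - I" for w
  proof (rule ccontr)
    assume no: "\<not> (\<exists>v\<in>I. (v, w) \<in> parcs G)"
    have "(w, w) \<notin> parcs G" using pair_no_loops by force
    then have "insert w I \<in> ?F" using I w no arc_swap[OF assms] by auto
    with max w show False by blast
  qed
  with I that show thesis by blast
qed

text \<open>\<open>r\<close> encodes the linear order on \<open>I\<close>, and \<open>c\<close>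
  picks the first neighbour. The proof follows the path \<open>w\<close>, \<open>c w\<close>,
  \<open>z\<close>, \<open>c z\<close>, whose edges lie in \<open>M\<close>, \<open>M'\<close>,
  \<open>M\<close> in turn: minimality of \<open>c w\<close> and the choice of \<open>c z\<close>
  force \<open>c z = c w\<close>, so the last edge would lie in \<open>M'\<close>.\<close>

lemma complete_forcing_set_complement:
  assumes G: "pair_graph G"
    and indep: "\<And>u v. u \<in> I \<Longrightarrow> v \<in> I \<Longrightarrow> (u, v) \<notin> parcs G"
    and inj: "inj_on (r :: 'a \<Rightarrow> nat) I"
    and c: "\<And>w. w \<in> pverts G - I \<Longrightarrow> c w \<in> I"
    and least: "\<And>w v. w \<in> pverts G - I \<Longrightarrow> v \<in> I \<Longrightarrow> (v, w) \<in> parcs G \<Longrightarrow> r (c w) \<le> r v"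
  shows "complete_forcing_set G (edges G - (\<lambda>w. {w, c w}) ` (pverts G - I))"
    (is "complete_forcing_set G (edges G - ?T)")
proof -
  interpret pair_graph G by fact
  have "M' = M" if M: "perfect_matching G M" and M': "perfect_matching G M'"
    and sub: "(edges G - ?T) \<inter> M \<subseteq> M'" for M M'
  proof (rule ccontr)
    assume "M' \<noteq> M"
    then have "M - M' \<noteq> {}" using perfect_matching_subset_eq[OF M M'] by auto
    moreover have T: "M - M' \<subseteq> ?T" using M sub by (auto simp: perfect_matching_def)
    ultimately obtain w0 where "w0 \<in> pverts G - I \<and> {w0, c w0} \<in> M - M'" by blast
    then obtain w where w: "w \<in> pverts G - I" "{w, c w} \<in> M - M'"
      and min: "\<And>z. z \<in> pverts G - I \<Longrightarrow> {z, c z} \<in> M - M' \<Longrightarrow> r (c w) \<le> r (c z)"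
      using ex_has_least_nat[of "\<lambda>w. w \<in> pverts G - I \<and> {w, c w} \<in> M - M'" w0 "\<lambda>w. r (c w)"]
      by blast
    have "c w \<in> pverts G" using w(2) M by (auto simp: perfect_matching_def)
    then obtain z where z: "{c w, z} \<in> M'" using perfect_matching_partner[OF M'] by blast
    then have arc: "(c w, z) \<in> parcs G"
      using M' edge_iff_arc[OF G] by (auto simp: perfect_matching_def)
    have zI: "z \<in> pverts G - I"
      using arc c[OF w(1)] indep in_arcsD2[OF arc] by auto
    obtain y where y: "{z, y} \<in> M" using perfect_matching_partner[OF M] zI by blast
    \<comment> \<open>Otherwise it is the \<open>M'\<close>-edge \<open>{c w, z}\<close>; as an
      \<open>M\<close>-edge at \<open>c w\<close> it is then also \<open>{w, c w}\<close>, which is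
      not in \<open>M'\<close>.\<close>
    have "{z, y} \<notin> M'"
    proof
      assume "{z, y} \<in> M'"
      then have "{z, y} = {c w, z}"
        using perfect_matching_unique_edge[OF M' _ z] by blast
      moreover from this have "{z, y} = {w, c w}"
        using perfect_matching_unique_edge[OF M y] w(2) by blast
      ultimately show False using z w(2) by simp
    qed
    \<comment> \<open>As \<open>c w'\<close> lies in \<open>I\<close> and \<open>z\<close> does not,
      \<open>z\<close> must be the end \<open>w'\<close>.\<close>
    with y T obtain w' where w': "w' \<in> pverts G - I" "{z, y} = {w', c w'}" by blast
    with zI c have "z = w'" by (metis DiffD2 insertI1 insertE singletonD)
    with w' have zy: "{z, y} = {z, c z}" by simp
    have "r (c w) \<le> r (c z)" using min[OF zI] y \<open>{z, y} \<notin> M'\<close> zy by simp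
    moreover have "r (c z) \<le> r (c w)" using least[OF zI c[OF w(1)] arc] .
    ultimately have "c z = c w" using inj c[OF zI] c[OF w(1)] by (auto dest: inj_onD)
    with zy z \<open>{z, y} \<notin> M'\<close> show False by (simp add: insert_commute)
  qed
  then show ?thesis
    unfolding complete_forcing_set_def forcing_set_def by blast
qed

text \<open>This is \<open>cf \<le> |E| - n / 2\<close>, arranged to avoid subtraction and halving
  in \<open>nat\<close>.\<close>

lemma complete_forcing_number_le:
  assumes G: "pair_graph G" and M: "perfect_matching G M"
  shows "2 * complete_forcing_number G + card (pverts G) \<le> 2 * card (edges G)"
proof -
  interpret pair_graph G by fact
  obtain I where I: "I \<subseteq> pverts G"
    and indep: "\<And>u v. u \<in> I \<Longrightarrow> v \<in> I \<Longrightarrow> (u, v) \<notin> parcs G"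
    and dom: "\<And>w. w \<in> pverts G - I \<Longrightarrow> \<exists>v\<in>I. (v, w) \<in> parcs G"
    using maximal_independent_set[OF G] by blast
  have finI: "finite I" using I pair_finite_verts finite_subset by blast
  then obtain r :: "'a \<Rightarrow> nat" where r: "inj_on r I"
    using finite_imp_inj_to_nat_seg by blast
  have "\<exists>v. (v \<in> I \<and> (v, w) \<in> parcs G) \<and> (\<forall>u. u \<in> I \<and> (u, w) \<in> parcs G \<longrightarrow> r v \<le> r u)"
    if "w \<in> pverts G - I" for w
    using dom[OF that] ex_has_least_nat[of "\<lambda>v. v \<in> I \<and> (v, w) \<in> parcs G" _ r] by blast
  then obtain c where c: "\<And>w. w \<in> pverts G - I \<Longrightarrow> c w \<in> I \<and> (c w, w) \<in> parcs G"
    and least: "\<And>w u. w \<in> pverts G - I \<Longrightarrow> u \<in> I \<Longrightarrow> (u, w) \<in> parcs G \<Longrightarrow> r (c w) \<le> r u"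
    by metis
  define T where "T = (\<lambda>w. {w, c w}) ` (pverts G - I)"
  have "complete_forcing_set G (edges G - T)"
    unfolding T_def using complete_forcing_set_complement[OF G indep r] c least by blast
  then have le: "complete_forcing_number G \<le> card (edges G - T)"
    unfolding complete_forcing_number_def by (intro Least_le) blast
  have TE: "T \<subseteq> edges G"
    using c edge_iff_arc[OF G] arc_swap[OF G] by (auto simp: T_def)
  \<comment> \<open>Each edge of \<open>T\<close> has exactly one end outside \<open>I\<close>, so
    it determines \<open>w\<close>.\<close>
  have "inj_on (\<lambda>w. {w, c w}) (pverts G - I)"
    using c by (auto simp: inj_on_def doubleton_eq_iff)
  then have cardT: "card T = card (pverts G - I)"
    by (simp add: T_def card_image)
  \<comment> \<open>Matching partners inject \<open>I\<close> into its complement, so at least half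
    of the vertices lie outside \<open>I\<close>.\<close>
  have "\<exists>w. {v, w} \<in> M" if "v \<in> I" for v
    using perfect_matching_partner[OF M] that I by blast
  then obtain p where p: "\<And>v. v \<in> I \<Longrightarrow> {v, p v} \<in> M" by metis
  have "p v \<in> pverts G - I" if "v \<in> I" for v
    using p[OF that] M edge_iff_arc[OF G] indep[OF that] by (auto simp: perfect_matching_def)
  moreover have "inj_on p I"
  proof (rule inj_onI)
    fix u v assume "u \<in> I" "v \<in> I" "p u = p v"
    then have "{u, p u} = {v, p u}"
      using perfect_matching_unique_edge[OF M p p] by (metis insertI1 insertI2)
    then show "u = v" by (auto simp: doubleton_eq_iff)
  qed
  ultimately have "card I \<le> card (pverts G - I)"
    using pair_finite_verts by (intro card_inj_on_le[of p]) auto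
  moreover have "card (pverts G - I) + card I = card (pverts G)"
    using I finI pair_finite_verts by (simp add: card_Diff_subset card_mono)
  moreover have "card (edges G - T) + card T = card (edges G)"
    using TE finite_edges[OF G] finite_subset[OF TE]
    by (simp add: card_Diff_subset card_mono)
  ultimately show ?thesis using le cardT by linarith
qed

theorem theorem1:
  fixes G :: "'a pair_pre_digraph"
  assumes "pair_graph G"
    and "Digraph_Component.connected (with_proj G)"
    and "\<exists>M. perfect_matching G M"
  shows "real (complete_forcing_number G) \<le>
    (1 - 1 / graph_spectral_radius G) * real (card (edges G))"
proof -
  let ?\<rho> = "graph_spectral_radius G"
  have ne: "pverts G \<noteq> {}"
    using assms(2) by (auto simp: connected_def strongly_connected_def)
  have cf: "2 * complete_forcing_number G + card (pverts G) \<le> 2 * card (edges G)"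
    using assms(1,3) complete_forcing_number_le by blast
  have avg: "2 * real (card (edges G)) \<le> ?\<rho> * real (card (pverts G))"
    using average_degree_le_spectral_radius[OF assms(1) ne] .
  have "card (pverts G) > 0"
    using ne assms(1) by (simp add: card_gt_0_iff pair_graph_def pair_digraph_def
        pair_fin_digraph_def pair_fin_digraph_axioms_def)
  \<comment> \<open>A vertex forces an edge through \<open>cf\<close>, and then \<open>avg\<close>
    forces \<open>?\<rho> > 0\<close>, which allows dividing \<open>avg\<close> by
    \<open>?\<rho>\<close>.\<close>
  with cf have "0 < card (edges G)" by linarith
  with avg have "?\<rho> > 0"
    by (smt (verit) mult_nonpos_nonneg of_nat_0_le_iff of_nat_0_less_iff)
  with avg have "real (card (edges G)) / ?\<rho> \<le> real (card (pverts G)) / 2"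
    by (simp add: field_simps)
  then show ?thesis using cf by (simp add: left_diff_distrib)
qed

end
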